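(* Let $A$ be a $2$-dimensional vector space (algebra) over the field $\mathbb{F}_2$ with two elements, with basis $\{e_1,e_2\}$, and put $e_3=e_1+e_2$. Then there is a one-to-one correspondence between the changes of basis of $A$ (the elements of $GL(A)\cong GL(2,\mathbb{F}_2)$) and the symmetric group $\Sigma_3$, given by associating to $f\in GL(A)$ the permutation it induces on the set $\{e_1,e_2,e_3\}$.
   Context: $\Sigma_3$ denotes the symmetric group on three letters, acting on $\{e_1,e_2,e_3\}$ by permuting indices. *)

theory Defs
  imports "HOL-Analysis.Cartesian_Space" "HOL-Algebra.Sym_Groups" "HOL-Library.Z2"
begin

text \<open>The vector space is the whole type \<^typ>\<open>'a\<close>, with scalar multiplication \<open>smul\<close>.\<close>

definition GL :: "('k::field \<Rightarrow> 'a::ab_group_add \<Rightarrow> 'a) \<Rightarrow> ('a \<Rightarrow> 'a) monoid"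
  where "GL smul =
    \<lparr>carrier = {f. Vector_Spaces.linear smul smul f \<and> bij f}, mult = (\<circ>), one = id\<rparr>"

definition GL_matrix :: "('k::field ^ 'n ^ 'n) monoid"
  where "GL_matrix = \<lparr>carrier = {M. invertible M}, mult = (**), one = mat 1\<rparr>"

text \<open>\<open>\<sigma>\<close> is the permutation that \<open>f\<close> induces on the set \<open>{e 1, e 2, e 3}\<close>, where a permutation
  of the letters \<open>1, 2, 3\<close> acts on this set by permuting indices.\<close>

definition induces_perm :: "(nat \<Rightarrow> 'a) \<Rightarrow> ('a \<Rightarrow> 'a) \<Rightarrow> (nat \<Rightarrow> nat) \<Rightarrow> bool"
  where "induces_perm e f \<sigma> \<longleftrightarrow>
    \<sigma> \<in> carrier (sym_group 3) \<and> (\<forall>i\<in>{1..3}. f (e i) = e (\<sigma> i))"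

definition induced_perm :: "(nat \<Rightarrow> 'a) \<Rightarrow> ('a \<Rightarrow> 'a) \<Rightarrow> (nat \<Rightarrow> nat)"
  where "induced_perm e f = (THE \<sigma>. induces_perm e f \<sigma>)"

end

theory Submission
  imports Defs
begin

text \<open>The nonzero vectors of the plane over the field with two elements are exactly \<open>e 1\<close>, \<open>e 2\<close>,
  \<open>e 3\<close>, and any two distinct ones add up to the third. Hence a linear bijection permutes them and is
  determined by that permutation; conversely every permutation, extended by \<open>0 \<mapsto> 0\<close>, is additive
  and therefore linear, since the only scalars are \<open>0\<close> and \<open>1\<close>.\<close>

section \<open>Linear automorphisms as invertible matrices\<close>

lemma GL_iso_GL_matrix:
  fixes \<phi> :: "'k::field ^ 'n \<Rightarrow> 'a::ab_group_add"
  assumes lin: "Vector_Spaces.linear (*s) smul \<phi>" and bij: "bij \<phi>"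
  shows "GL smul \<cong> (GL_matrix :: ('k ^ 'n ^ 'n) monoid)"
proof -
  interpret \<phi>: Vector_Spaces.linear "(*s)" smul \<phi> by (rule lin)
  define \<psi> where "\<psi> = inv_into UNIV \<phi>"
  have \<phi>\<psi>: "\<phi> (\<psi> x) = x" and \<psi>\<phi>: "\<psi> (\<phi> v) = v" for x v
    using bij by (simp_all add: \<psi>_def bij_is_surj surj_f_inv_f bij_is_inj)
  have bij': "bij \<psi>"
    using bij by (simp add: \<psi>_def bij_imp_bij_inv)
  have lin': "Vector_Spaces.linear smul (*s) \<psi>"
    unfolding Vector_Spaces.linear_iff
    using lin by (auto simp: Vector_Spaces.linear_iff) (metis \<phi>\<psi> \<psi>\<phi> \<phi>.add \<phi>.scale)+
  \<comment> \<open>With \<open>\<phi>\<close> read as a choice of coordinates, \<open>h f\<close>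
    is the matrix of \<open>f\<close> and \<open>g M\<close> is the map with matrix
    \<open>M\<close>.\<close>
  define h where "h f = matrix (\<psi> \<circ> f \<circ> \<phi>)" for f
  define g where "g M = \<phi> \<circ> (*v) M \<circ> \<psi>" for M :: "'k ^ 'n ^ 'n"
  have linear_conj: "Vector_Spaces.linear (*s) (*s) (\<psi> \<circ> f \<circ> \<phi>)"
    if "f \<in> carrier (GL smul)" for f
    using that lin lin' by (auto simp: GL_def intro!: Vector_Spaces.linear_compose)
  have bij_conj: "bij (\<psi> \<circ> f \<circ> \<phi>)" if "f \<in> carrier (GL smul)" for f
    using that bij bij' by (auto simp: GL_def intro!: bij_comp)
  have h_carrier: "h f \<in> carrier GL_matrix" if "f \<in> carrier (GL smul)" for f
  proof -
    \<comment> \<open>The matrix acts as the conjugated map, hence injectively; for a square matrix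
      this already gives a two-sided inverse.\<close>
    have "(*v) (h f) = \<psi> \<circ> f \<circ> \<phi>"
      using matrix_works[OF linear_conj[OF that]] by (auto simp: h_def)
    with bij_conj[OF that] show ?thesis
      by (simp add: GL_matrix_def invertible_left_inverse matrix_left_invertible_injective bij_is_inj)
  qed
  have g_carrier: "g M \<in> carrier (GL smul)" if "M \<in> carrier GL_matrix" for M
  proof -
    have "inj ((*v) M)" "surj ((*v) M)"
      using that invertible_left_inverse[of M] invertible_right_inverse[of M]
      by (simp_all add: GL_matrix_def matrix_left_invertible_injective
          matrix_right_invertible_surjective)
    then show ?thesis
      using bij bij' lin lin'
      by (simp add: GL_def g_def bij_comp bijI)
        (intro Vector_Spaces.linear_compose, auto)
  qed
  have gh: "g (h f) = f" if "f \<in> carrier (GL smul)" for f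
    using matrix_works[OF linear_conj[OF that]] by (simp add: g_def h_def fun_eq_iff \<phi>\<psi>)
  have hg: "h (g M) = M" for M
    by (simp add: g_def h_def comp_def \<psi>\<phi>)
  have "h (f \<circ> f') = h f ** h f'"
    if "f \<in> carrier (GL smul)" "f' \<in> carrier (GL smul)" for f f'
    \<comment> \<open>The inner \<open>\<phi> \<circ> \<psi>\<close> cancels, so conjugation
      respects composition, and composition becomes the matrix product.\<close>
    using matrix_compose_gen[OF linear_conj[OF that(2)] linear_conj[OF that(1)]]
    by (simp add: h_def comp_def \<phi>\<psi>)
  then have "h \<in> hom (GL smul) GL_matrix"
    using h_carrier by (auto simp: hom_def) (auto simp: GL_def GL_matrix_def)
  moreover have "bij_betw h (carrier (GL smul)) (carrier GL_matrix)"
    by (rule bij_betw_byWitness[where f' = g]) (use gh hg h_carrier g_carrier in auto)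
  ultimately show ?thesis
    by (intro is_isoI isoI)
qed

section \<open>The plane over the field with two elements\<close>

locale bit_plane = vector_space smul
  for smul :: "bit \<Rightarrow> 'a::ab_group_add \<Rightarrow> 'a" +
  fixes e :: "nat \<Rightarrow> 'a"
  assumes basis_distinct: "e 1 \<noteq> e 2"
    and basis_independent: "\<not> dependent {e 1, e 2}"
    and basis_span: "span {e 1, e 2} = UNIV"
    and e3: "e 3 = e 1 + e 2"
begin

lemma add_self: "x + x = 0" for x :: 'a
proof -
  have "smul 1 x + smul 1 x = smul (1 + 1) x"
    by (simp only: scale_left_distrib)
  then show ?thesis
    by simp
qed

lemma add_eq_0_iff_eq: "x + y = 0 \<longleftrightarrow> x = y" for x y :: 'a
  by (metis add_self add_left_cancel)

lemma add_self_left: "x + (x + y) = y" for x y :: 'a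
  by (metis add_self add.assoc add_0)

lemma linear_iff_additive:
  "Vector_Spaces.linear smul smul f \<longleftrightarrow> (\<forall>x y. f (x + y) = f x + f y)"
proof
  assume additive: "\<forall>x y. f (x + y) = f x + f y"
  \<comment> \<open>Indeed \<open>f 0 = f (x + x) = f x + f x = 0\<close>; this settles the scalar
    \<open>0\<close>.\<close>
  then have "f 0 = 0"
    by (metis add_self)
  then have "f (smul c x) = smul c (f x)" for c x
    by (cases c) auto
  with additive show "Vector_Spaces.linear smul smul f"
    by (simp add: Vector_Spaces.linear_iff vector_space_axioms)
qed (simp add: Vector_Spaces.linear_iff)

text \<open>A set containing \<open>0\<close> is dependent, which settles \<open>e 1\<close> and
  \<open>e 2\<close>; in characteristic two, \<open>e 3 = 0\<close> would mean
  \<open>e 1 = e 2\<close>.\<close>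

lemma e_nonzero: "e 1 \<noteq> 0" "e 2 \<noteq> 0" "e 3 \<noteq> 0"
  using basis_independent dependent_zero[of "{e 1, e 2}"] basis_distinct
  by (auto simp: e3 add_eq_0_iff_eq)

lemma letters: "{1..3} = {1, 2, 3::nat}"
  by auto

text \<open>Coefficients in \<open>bit\<close> leave only four linear combinations of
  \<open>e 1\<close> and \<open>e 2\<close>.\<close>

lemma UNIV_eq: "(UNIV :: 'a set) = {0, e 1, e 2, e 3}"
proof -
  have "x \<in> {0, e 1, e 2, e 3}" for x
  proof -
    have "x \<in> span {e 1, e 2}"
      using basis_span by blast
    then obtain a b where "x - smul a (e 1) = smul b (e 2)"
      by (auto simp: span_insert span_singleton)
    then have "x = smul a (e 1) + smul b (e 2)"
      by (simp add: algebra_simps)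
    then show ?thesis
      by (cases a; cases b) (auto simp: e3)
  qed
  then show ?thesis
    by auto
qed

lemma inj_on_e: "inj_on e {1..3}"
  \<comment> \<open>\<open>e 1 = e 3\<close> would force \<open>e 2 = 0\<close>, and
    \<open>e 2 = e 3\<close> would force \<open>e 1 = 0\<close>.\<close>
  using basis_distinct e_nonzero unfolding letters by (auto simp: e3 inj_on_def)

lemma bij_betw_e: "bij_betw e {1..3} (UNIV - {0})"
  using inj_on_e e_nonzero unfolding bij_betw_def letters UNIV_eq by auto

lemma vector_cases:
  fixes x :: 'a
  obtains "x = 0" | i where "i \<in> {1..3}" "x = e i"
  using bij_betw_e unfolding bij_betw_def by blast

text \<open>The relation \<open>e 1 + e 2 + e 3 = 0\<close> is symmetric in the letters. An
  arbitrary labelling lets the lemma apply to letters and to their images under a permutation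
  alike.\<close>

lemma add_e_distinct:
  assumes "{i, j, k} = {1..3}" "i \<noteq> j"
  shows "e i + e j = e k"
proof -
  \<comment> \<open>The cardinality excludes labellings with a repeated letter.\<close>
  have "i \<in> {1, 2, 3}" "j \<in> {1, 2, 3}" "k \<in> {1, 2, 3}" "card {i, j, k} = 3"
    using assms(1) unfolding letters[symmetric] by auto
  then show ?thesis
    using assms(2) by (auto simp: e3 add_self add_self_left add.commute card_insert_if
        add.left_commute split: if_splits)
qed

text \<open>A permutation sends the letter other than \<open>i\<close> and \<open>j\<close> to the
  letter other than \<open>\<sigma> i\<close> and \<open>\<sigma> j\<close>, so sums of distinct
  nonzero vectors are preserved.\<close>

lemma additive_perm:
  assumes \<sigma>: "\<sigma> permutes {1..3}" and f0: "f 0 = 0"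
    and f: "\<And>i. i \<in> {1..3} \<Longrightarrow> f (e i) = e (\<sigma> i)"
  shows "f (x + y) = f x + f y"
proof -
  consider "x = 0" | "y = 0" | "x = y" | i j where
    "x = e i" "y = e j" "i \<in> {1..3}" "j \<in> {1..3}" "i \<noteq> j"
    by (metis vector_cases)
  then show ?thesis
  proof cases
    case 4
    \<comment> \<open>The three letters add up to 6, so this is the remaining one.\<close>
    define k where "k = 6 - i - j"
    have ijk: "{i, j, k} = {1..3}"
      using 4 unfolding k_def by auto
    have "{\<sigma> i, \<sigma> j, \<sigma> k} = {1..3}"
      using permutes_image[OF \<sigma>] unfolding ijk[symmetric] by simp
    moreover have "k \<in> {1..3}"
      using ijk by blast
    moreover have "\<sigma> i \<noteq> \<sigma> j"
      using 4(5) permutes_inj[OF \<sigma>] by (auto dest: injD)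
    ultimately show ?thesis
      using add_e_distinct[OF ijk 4(5)] add_e_distinct[of "\<sigma> i" "\<sigma> j" "\<sigma> k"] f 4 by simp
  qed (simp_all add: f0 add_self)
qed

section \<open>Linear bijections and permutations of the letters\<close>

lemma ex_induces_perm:
  assumes "f \<in> carrier (GL smul)"
  shows "\<exists>\<sigma>. induces_perm e f \<sigma>"
proof -
  let ?c = "inv_into {1..3} e"
  have "f 0 = 0" "bij f"
    using assms by (auto simp: GL_def linear_iff_additive) (metis add_self)
  then have "bij_betw f (UNIV - {0}) (UNIV - {0})"
    by (metis bij_betw_DiffI bij_betw_singletonI subset_UNIV)
  \<comment> \<open>Numbering the nonzero vectors by \<open>e\<close> turns the restriction of
    \<open>f\<close> into a bijection of the letters.\<close>
  then have "bij_betw (?c \<circ> f \<circ> e) {1..3} {1..3}"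
    using bij_betw_e bij_betw_inv_into[OF bij_betw_e] by (blast intro: bij_betw_trans)
  \<comment> \<open>\<open>permutes\<close> asks for a function on all naturals that is the identity
    off the letters.\<close>
  then have "restrict_id (?c \<circ> f \<circ> e) {1..3} permutes {1..3}"
    by (rule permutes_restrict_id)
  moreover have "e (?c (f (e i))) = f (e i)" if "i \<in> {1..3}" for i
    using bij_betw_e \<open>bij_betw f (UNIV - {0}) (UNIV - {0})\<close> that
    by (metis bij_betw_apply bij_betw_inv_into_right)
  ultimately show ?thesis
    by (auto simp: induces_perm_def sym_group_carrier)
qed

text \<open>Injectivity of \<open>e\<close> fixes the values on the letters, and off them both
  permutations are the identity. Hence the description in \<open>induced_perm\<close> is
  definite.\<close>

lemma induces_perm_unique:
  assumes "induces_perm e f \<sigma>" "induces_perm e f \<tau>"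
  shows "\<sigma> = \<tau>"
proof
  fix i
  show "\<sigma> i = \<tau> i"
  proof (cases "i \<in> {1..3}")
    case True
    then show ?thesis
      using assms inj_on_e
      by (metis induces_perm_def inj_onD permutes_in_image sym_group_carrier)
  next
    case False
    then show ?thesis
      using assms by (metis induces_perm_def permutes_not_in sym_group_carrier)
  qed
qed

lemma ex1_induces_perm: "f \<in> carrier (GL smul) \<Longrightarrow> \<exists>!\<sigma>. induces_perm e f \<sigma>"
  using ex_induces_perm induces_perm_unique by blast

lemma induces_induced_perm: "f \<in> carrier (GL smul) \<Longrightarrow> induces_perm e f (induced_perm e f)"
  unfolding induced_perm_def by (rule theI'[OF ex1_induces_perm])

lemma ex_GL_induces_perm:
  assumes "\<sigma> permutes {1..3}"
  shows "\<exists>f \<in> carrier (GL smul). induces_perm e f \<sigma>"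
proof -
  let ?c = "inv_into {1..3} e"
  \<comment> \<open>This carries \<open>\<sigma>\<close> over to the nonzero vectors through their
    numbering; \<open>0\<close> has no number and stays fixed.\<close>
  define f where "f x = (if x = 0 then 0 else e (\<sigma> (?c x)))" for x
  have f_e: "f (e i) = e (\<sigma> i)" if "i \<in> {1..3}" for i
    using that bij_betw_e inj_on_e by (force simp: f_def bij_betw_def)
  have f0: "f 0 = 0"
    by (simp add: f_def)
  have "bij_betw (e \<circ> (\<sigma> \<circ> ?c)) (UNIV - {0}) (UNIV - {0})"
    using bij_betw_inv_into[OF bij_betw_e] permutes_imp_bij[OF assms] bij_betw_e
    by (blast intro: bij_betw_trans)
  then have "bij_betw f (UNIV - {0}) (UNIV - {0})"
    by (rule bij_betw_cong[THEN iffD1, rotated]) (simp add: f_def)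
  then have "bij_betw f ((UNIV - {0}) \<union> {0}) ((UNIV - {0}) \<union> {0})"
    by (intro bij_betw_combine) (auto simp: f0 bij_betw_def)
  then have "bij f"
    by (simp add: Un_commute)
  then have "f \<in> carrier (GL smul)"
    using additive_perm[of \<sigma> f] assms f0 f_e by (simp add: GL_def linear_iff_additive)
  moreover have "induces_perm e f \<sigma>"
    using assms f_e by (simp add: induces_perm_def sym_group_carrier)
  ultimately show ?thesis
    by blast
qed

lemma bij_betw_induced_perm:
  "bij_betw (induced_perm e) (carrier (GL smul)) (carrier (sym_group 3))"
proof (rule bij_betwI')
  fix f g
  assume fg: "f \<in> carrier (GL smul)" "g \<in> carrier (GL smul)"
  show "induced_perm e f = induced_perm e g \<longleftrightarrow> f = g"
  proof
    assume "induced_perm e f = induced_perm e g"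
    then have "f (e i) = g (e i)" if "i \<in> {1..3}" for i
      using fg[THEN induces_induced_perm] that by (simp add: induces_perm_def)
    moreover have "f 0 = 0" "g 0 = 0"
      using fg by (auto simp: GL_def linear_iff_additive) (metis add_self)+
    \<comment> \<open>Zero and the three \<open>e i\<close> exhaust the plane.\<close>
    ultimately show "f = g"
      by (metis ext vector_cases)
  qed simp
next
  fix f
  assume "f \<in> carrier (GL smul)"
  then show "induced_perm e f \<in> carrier (sym_group 3)"
    using induces_induced_perm by (simp add: induces_perm_def)
next
  fix \<sigma>
  assume "\<sigma> \<in> carrier (sym_group 3)"
  then obtain f where "f \<in> carrier (GL smul)" "induces_perm e f \<sigma>"
    using ex_GL_induces_perm by (auto simp: sym_group_carrier)
  then show "\<exists>f \<in> carrier (GL smul). \<sigma> = induced_perm e f"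
    using induces_induced_perm induces_perm_unique by blast
qed

section \<open>Coordinates with respect to the basis\<close>

lemma GL_iso_GL_matrix_2: "GL smul \<cong> (GL_matrix :: (bit ^ 2 ^ 2) monoid)"
proof (rule GL_iso_GL_matrix)
  let ?\<phi> = "\<lambda>v :: bit ^ 2. smul (v $ 1) (e 1) + smul (v $ 2) (e 2)"
  show lin: "Vector_Spaces.linear (*s) smul ?\<phi>"
    unfolding Vector_Spaces.linear_iff
  proof (intro conjI allI vector_space_axioms vec.vector_space_axioms)
    show "?\<phi> (v + w) = ?\<phi> v + ?\<phi> w" for v w
      by (simp only: vector_add_component scale_left_distrib add_ac)
    show "?\<phi> (c *s v) = smul c (?\<phi> v)" for c v
      by (cases c) simp_all
  qed
  interpret \<phi>: Vector_Spaces.linear "(*s)" smul ?\<phi> by (rule lin)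
  \<comment> \<open>Coordinates other than (0, 0) give \<open>e 1\<close>, \<open>e 2\<close> or
    \<open>e 1 + e 2\<close>, none of them zero.\<close>
  have "v = 0" if "?\<phi> v = 0" for v
    using that e_nonzero unfolding e3
    by (cases "v $ 1"; cases "v $ 2") (auto simp: vec_eq_iff forall_2)
  then have "inj ?\<phi>"
    by (subst \<phi>.inj_iff_eq_0) blast
  \<comment> \<open>The four coordinate vectors hit \<open>0\<close>, \<open>e 1\<close>,
    \<open>e 2\<close> and \<open>e 3\<close> in turn.\<close>
  moreover have "UNIV \<subseteq> range ?\<phi>"
    unfolding UNIV_eq
    using rangeI[of ?\<phi> "vector [0, 0]"] rangeI[of ?\<phi> "vector [1, 0]"]
      rangeI[of ?\<phi> "vector [0, 1]"] rangeI[of ?\<phi> "vector [1, 1]"]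
    by (simp add: e3)
  ultimately show "bij ?\<phi>"
    by (auto simp: bij_def)
qed

end

theorem theorem7:
  fixes smul :: "bit \<Rightarrow> 'a::ab_group_add \<Rightarrow> 'a"
    and e :: "nat \<Rightarrow> 'a"
  assumes "vector_space smul"
    and "e 1 \<noteq> e 2"
    and "\<not> module.dependent smul {e 1, e 2}"
    and "module.span smul {e 1, e 2} = UNIV"
    and "e 3 = e 1 + e 2"
  shows "GL smul \<cong> (GL_matrix :: (bit ^ 2 ^ 2) monoid)
    \<and> (\<forall>f \<in> carrier (GL smul). \<exists>!\<sigma>. induces_perm e f \<sigma>)
    \<and> bij_betw (induced_perm e) (carrier (GL smul)) (carrier (sym_group 3))"
proof -
  interpret bit_plane smul e
    using assms by (simp add: bit_plane_def bit_plane_axioms_def)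
  show ?thesis
    using GL_iso_GL_matrix_2 ex1_induces_perm bij_betw_induced_perm by blast
qed

end
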